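(* Let $\mathbf{k}=(k_n)$ be a sequence in $\mathbb{N}$. Suppose that $\mathfrak{u}$ is a nonprincipal ultrafilter in $\mathbb{N}$ and that $(r_n)$ and $(s_n)$ are sequences in $(0,1)$ such that $\lim_{\mathfrak{u}}{r_n}^{k_n}=\lim_{\mathfrak{u}}{s_n}^{k_n}\neq 0,1$. If $\mathbf{z}=(z_n)$ is a sequence in $\mathbb{D}$ with $r_n<|z_n|$ and $s_n<|z_n|$ for all $n$, then $\lim_{\mathfrak{u}}\zeta_{D^+(z_n,r_n)}=\lim_{\mathfrak{u}}\zeta_{D^+(z_n,s_n)}$.
   Context: $\mathbb{K}$ is an algebraically closed field, complete with respect to a nontrivial nonarchimedean absolute value $|\cdot|$; $\mathbb{D} = \{z \in \mathbb{K} : |z|<1\}$; $\mathbb{N}=\{1,2,\dots\}$. $H^\infty$ is the Banach $\mathbb{K}$-algebra of bounded power series $f(z)=\sum_{n\ge 0} a_n z^n$ on $\mathbb{D}$, with norm $\|f\| = \sup_n |a_n| = \sup_{z\in\mathbb{D}}|f(z)|$. $D^+(z,r)$ is the closed disk with center $z$ and radius $r$, and for a disk $D\subset\mathbb{D}$, $\zeta_D(f) := \sup_{z\in D}|f(z)|$ for $f\in H^\infty$ (a multiplicative seminorm bounded by $\|\cdot\|$). $\lim_{\mathfrak{u}}$ of a sequence of such seminorms is the pointwise limit on $H^\infty$ along $\mathfrak{u}$. *)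

theory Defs
  imports "HOL-Analysis.Analysis"
begin

text \<open>
  A field with a nontrivial nonarchimedean absolute value, metrised by it. Positivity and
  definiteness of \<open>absval\<close> follow from \<open>absval x = dist x 0\<close>. The class
  \<open>real_normed_field\<close> is not applicable, since a real normed algebra is archimedean, and
  \<open>norm\<close> itself is constrained to real normed vector spaces.
\<close>

class nonarchimedean_field = field + metric_space +
  fixes absval :: "'a \<Rightarrow> real"
  assumes dist_absval: "dist x y = absval (x - y)"
    and absval_mult: "absval (x * y) = absval x * absval y"
    and absval_add: "absval (x + y) \<le> max (absval x) (absval y)"
    and absval_nontrivial: "\<exists>x. x \<noteq> 0 \<and> absval x \<noteq> 1"

text \<open>
  The library constant \<open>eval_fps\<close> is restricted to real normed algebras.
\<close>

definition fps_value :: "'a::nonarchimedean_field fps \<Rightarrow> 'a \<Rightarrow> 'a" where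
  "fps_value f w = (\<Sum>n. fps_nth f n * w ^ n)"

definition H_infinity :: "'a::nonarchimedean_field fps set" where
  "H_infinity = {f. (\<forall>w\<in>ball 0 1. summable (\<lambda>n. fps_nth f n * w ^ n)) \<and>
                    bounded (fps_value f ` ball 0 1)}"

text \<open>
  Meaningful for \<open>f \<in> H_infinity\<close> and nonempty \<open>D \<subseteq> ball 0 1\<close>, where the supremum
  is over a nonempty bounded set.
\<close>

definition disk_seminorm :: "'a::nonarchimedean_field set \<Rightarrow> 'a fps \<Rightarrow> real" where
  "disk_seminorm D f = (SUP w\<in>D. absval (fps_value f w))"

definition is_ultrafilter :: "'i filter \<Rightarrow> bool" where
  "is_ultrafilter F \<longleftrightarrow>
     F \<noteq> bot \<and> (\<forall>P. eventually P F \<or> eventually (\<lambda>i. \<not> P i) F)"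

definition nonprincipal :: "'i filter \<Rightarrow> bool" where
  "nonprincipal F \<longleftrightarrow> (\<forall>i. F \<noteq> principal {i})"

text \<open>
  \<open>\<phi>\<close> is the limit along \<open>F\<close> of the seminorms \<open>\<Phi> n\<close>, pointwise on \<open>H_infinity\<close>.
  It determines \<open>\<phi>\<close> on \<open>H_infinity\<close> whenever \<open>F \<noteq> bot\<close>.
\<close>

definition seminorm_limit ::
    "(nat \<Rightarrow> 'a::nonarchimedean_field fps \<Rightarrow> real) \<Rightarrow> ('a fps \<Rightarrow> real) \<Rightarrow> nat filter \<Rightarrow> bool" where
  "seminorm_limit \<Phi> \<phi> F \<longleftrightarrow> (\<forall>f\<in>H_infinity. ((\<lambda>n. \<Phi> n f) \<longlongrightarrow> \<phi> f) F)"

end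

theory Submission
  imports Defs
begin

text \<open>
  The seminorm of the disk of center \<open>z\<close> and radius \<open>t\<close> is Lipschitz in \<open>ln (- ln t)\<close>, locally
  in \<open>t\<close> and uniformly in \<open>z\<close>: if \<open>r \<le> s < 1\<close> and \<open>f\<close> is bounded by \<open>B\<close> on the unit disk, then

    \<open>0 \<le> disk_seminorm (cball z s) f - disk_seminorm (cball z r) f \<le> B * (ln r / ln s - 1)\<close>

  (lemmas \<open>disk_seminorm_mono\<close> and \<open>disk_seminorm_comparison\<close>). The reason
  is that the seminorm is the maximum of the \<open>absval b\<^sub>j * t ^ j\<close>, where \<open>b\<^sub>j\<close> are the Taylor
  coefficients of \<open>f\<close> at \<open>z\<close>. They are bounded by \<open>B\<close>, and \<open>s ^ j - r ^ j \<le> ln r / ln s - 1\<close> for all \<open>j\<close> simultaneously.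

  If \<open>r n ^ k n\<close> and \<open>s n ^ k n\<close> have the same limit \<open>c\<close>, with \<open>0 < c < 1\<close>, then
  \<open>ln (r n) / ln (s n)\<close>, being the quotient of the logarithms of these powers, tends to
  \<open>ln c / ln c = 1\<close>. So the difference of the two seminorms tends to 0 at every \<open>f\<close>. The seminorms
  at \<open>f\<close> take values in a compact interval, hence have a limit along the ultrafilter.

  Only polynomials are expanded at \<open>z\<close>: truncations of \<open>f\<close> converge to \<open>f\<close> uniformly on each smaller
  disk around 0, and such a disk contains the disks around \<open>z\<close>. For polynomials, the identification
  of the seminorm with the maximum of the terms is the Cauchy estimate \<open>poly_Cauchy_estimate\<close>. It
  uses that the values of \<open>absval\<close> are dense in the positive reals, because the field is
  algebraically closed: on a circle of generic radius the terms have distinct absolute values and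
  cannot cancel.
\<close>

section \<open>Ultrametric estimates\<close>

lemma absval_zero [simp]: "absval (0::'a::nonarchimedean_field) = 0"
  using dist_absval[of "0::'a" 0] by simp

lemma absval_pos: "x \<noteq> 0 \<Longrightarrow> absval (x::'a::nonarchimedean_field) > 0"
  using dist_absval[of x 0] by (metis diff_zero zero_less_dist_iff)

lemma absval_nonneg [simp]: "absval (x::'a::nonarchimedean_field) \<ge> 0"
  using dist_absval[of x 0] by (metis diff_zero zero_le_dist)

lemma absval_one [simp]: "absval (1::'a::nonarchimedean_field) = 1"
  using absval_mult[of "1::'a" 1] absval_pos[of "1::'a"] by simp

lemma absval_minus_commute: "absval (x - y) = absval (y - x)" for x y :: "'a::nonarchimedean_field"
  by (metis dist_absval dist_commute)

lemma absval_diff: "absval (x - y) \<le> max (absval x) (absval y)" for x y :: "'a::nonarchimedean_field"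
  using absval_add[of x "0 - y"] absval_minus_commute[of 0 y] by simp

lemma absval_power: "absval (x ^ n) = absval x ^ n" for x :: "'a::nonarchimedean_field"
  by (induction n) (simp_all add: absval_mult)

lemma absval_inverse: "absval (inverse x) = inverse (absval x)" for x :: "'a::nonarchimedean_field"
proof (cases "x = 0")
  case False
  then have "absval (inverse x) * absval x = 1"
    by (simp flip: absval_mult)
  then show ?thesis
    by (metis inverse_unique mult.commute)
qed auto

lemma absval_sum_le:
  fixes g :: "'b \<Rightarrow> 'a::nonarchimedean_field"
  assumes "\<And>i. i \<in> I \<Longrightarrow> absval (g i) \<le> B" and "0 \<le> B"
  shows "absval (sum g I) \<le> B"
  using assms
proof (induction I rule: infinite_finite_induct)
  case (insert i I)
  then have "absval (g i) \<le> B" "absval (sum g I) \<le> B" by auto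
  then show ?case
    using absval_add[of "g i" "sum g I"] insert.hyps by simp
qed auto

lemma absval_sum_less:
  fixes g :: "'b \<Rightarrow> 'a::nonarchimedean_field"
  assumes "\<And>i. i \<in> I \<Longrightarrow> absval (g i) < B" and "0 < B"
  shows "absval (sum g I) < B"
  using assms
proof (induction I rule: infinite_finite_induct)
  case (insert i I)
  then have "absval (g i) < B" "absval (sum g I) < B" by auto
  then show ?case
    using absval_add[of "g i" "sum g I"] insert.hyps by simp
qed auto

text \<open>
  No cancellation can occur between terms of different absolute value: the term of largest
  absolute value is strictly larger than the sum of the others.
\<close>

lemma absval_term_le_absval_sum:
  fixes g :: "'b \<Rightarrow> 'a::nonarchimedean_field"
  assumes fin: "finite I" and j: "j \<in> I"
    and distinct: "\<And>i i'. i \<in> I \<Longrightarrow> i' \<in> I \<Longrightarrow> i \<noteq> i' \<Longrightarrow> g i \<noteq> 0 \<Longrightarrow>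
      absval (g i) \<noteq> absval (g i')"
  shows "absval (g j) \<le> absval (sum g I)"
proof -
  obtain m where m: "m \<in> I" and max: "\<And>i. i \<in> I \<Longrightarrow> absval (g i) \<le> absval (g m)"
  proof -
    have "Max ((\<lambda>i. absval (g i)) ` I) \<in> (\<lambda>i. absval (g i)) ` I"
      using fin j by (intro Max_in) auto
    then obtain m where "m \<in> I" "absval (g m) = Max ((\<lambda>i. absval (g i)) ` I)"
      by auto
    with fin that show thesis by simp
  qed
  show ?thesis
  proof (cases "g m = 0")
    case True
    then show ?thesis using max[OF j] order_trans[OF _ absval_nonneg] by simp
  next
    case False
    have "absval (sum g (I - {m})) < absval (g m)"
    proof (rule absval_sum_less)
      fix i assume "i \<in> I - {m}"
      then show "absval (g i) < absval (g m)"
        using max[of i] distinct[of m i] m False by force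
    qed (simp add: absval_pos False)
    moreover have "g m = sum g I - sum g (I - {m})"
      using fin m by (simp add: sum.remove)
    ultimately have "absval (g m) \<le> absval (sum g I)"
      using absval_diff[of "sum g I" "sum g (I - {m})"] by simp
    then show ?thesis using max[OF j] by linarith
  qed
qed

section \<open>Density of the value group\<close>

text \<open>
  An \<open>n\<close>-th root of an element of absolute value greater than 1 has absolute value \<open>R > 1\<close>
  as close to 1 as desired. The powers of \<open>R\<close>, with positive and negative exponents, leave no
  gap of ratio greater than \<open>R\<close>.
\<close>

lemma absval_dense:
  fixes a b :: real
  assumes "0 < a" "a < b"
  shows "\<exists>x :: 'a::{nonarchimedean_field, alg_closed_field}. a < absval x \<and> absval x < b"
proof -
  obtain y :: 'a where y: "absval y > 1"
  proof -
    obtain x :: 'a where x: "x \<noteq> 0" "absval x \<noteq> 1"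
      using absval_nontrivial by blast
    show thesis
    proof (cases "absval x > 1")
      case False
      then have "absval (inverse x) > 1"
        using x absval_pos[of x] by (simp add: absval_inverse one_less_inverse)
      then show thesis by (rule that)
    qed (rule that)
  qed
  obtain n where n: "absval y < (b / a) ^ n"
    using real_arch_pow[of "b / a"] assms by auto
  have "n > 0" using n y by (cases n) auto
  then obtain u :: 'a where "u ^ n = y"
    using nth_root_exists by blast
  define R where "R = absval u"
  have Rn: "R ^ n = absval y"
    using \<open>u ^ n = y\<close> by (simp add: R_def flip: absval_power)
  have R0: "R \<ge> 0" by (simp add: R_def)
  have R1: "R > 1"
  proof (rule ccontr)
    assume "\<not> R > 1"
    then have "R ^ n \<le> 1" using R0 by (simp add: power_le_one)
    then show False using Rn y by simp
  qed
  have Rb: "R < b / a"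
    using n assms by (intro power_less_imp_less_base[of R n "b / a"]) (auto simp: Rn)
  obtain N where "1 / a < R ^ N"
    using real_arch_pow[OF R1] by blast
  then have N: "1 / R ^ N < a"
    using R1 assms by (simp add: field_simps)
  obtain M where M: "a * R ^ N < R ^ M"
    using real_arch_pow[OF R1] by blast
  define m where "m = (LEAST m. a * R ^ N < R ^ m)"
  have m: "a * R ^ N < R ^ m"
    unfolding m_def using M by (rule LeastI)
  have "m \<noteq> 0"
  proof
    assume "m = 0"
    then show False using m N R1 by (simp add: field_simps)
  qed
  then obtain l where l: "m = Suc l" by (cases m) auto
  have "\<not> a * R ^ N < R ^ l"
    using not_less_Least[of l "\<lambda>m. a * R ^ N < R ^ m"] l by (simp add: m_def)
  then have "R ^ m \<le> R * (a * R ^ N)"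
    using R1 l by simp
  also have "\<dots> < b / a * (a * R ^ N)"
    using Rb R1 assms by (intro mult_strict_right_mono) auto
  also have "\<dots> = b * R ^ N" using assms by simp
  finally have "R ^ m < b * R ^ N" .
  then have "a < absval (u ^ m * inverse (u ^ N)) \<and> absval (u ^ m * inverse (u ^ N)) < b"
    using m R1 by (simp add: absval_mult absval_inverse absval_power flip: R_def) (simp add: field_simps)
  then show ?thesis by blast
qed

lemma absval_dense_avoiding:
  fixes a b :: real
  assumes "0 < a" "a < b" "finite F"
  shows "\<exists>x :: 'a::{nonarchimedean_field, alg_closed_field}.
    a < absval x \<and> absval x < b \<and> absval x \<notin> F"
proof -
  define b' where "b' = Min (insert b (F \<inter> {a<..<b}))"
  have fin: "finite (insert b (F \<inter> {a<..<b}))" using assms by simp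
  have "b' > a" using assms by (simp add: b'_def)
  then obtain x :: 'a where x: "a < absval x" "absval x < b'"
    using absval_dense[OF \<open>0 < a\<close>] by blast
  have "b' \<le> b" unfolding b'_def using fin by (intro Min_le) auto
  moreover have "absval x \<notin> F"
  proof
    assume "absval x \<in> F"
    then have "b' \<le> absval x"
      unfolding b'_def using fin x \<open>b' \<le> b\<close> by (intro Min_le) auto
    then show False using x by simp
  qed
  ultimately show ?thesis using x by force
qed

section \<open>Polynomials on disks\<close>

text \<open>
  For all but finitely many radii \<open>\<rho>\<close> the nonzero terms of \<open>q\<close> have distinct absolute values
  on the circle of radius \<open>\<rho>\<close>, and then each of them is bounded by the value of \<open>q\<close>. Such
  radii \<open>\<rho>\<close> in the value group accumulate at \<open>r\<close> from the left.
\<close>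

lemma poly_Cauchy_estimate:
  fixes q :: "'a::{nonarchimedean_field, alg_closed_field} poly"
  assumes r: "0 < r" and bound: "\<And>w. absval w < r \<Longrightarrow> absval (poly q w) \<le> B"
  shows "absval (coeff q j) * r ^ j \<le> B"
proof (rule ccontr)
  define P where "P i = monom (absval (coeff q i)) i" for i
  \<comment> \<open>the roots of \<open>P i - P i'\<close> contain the radii at which terms \<open>i\<close> and \<open>i'\<close> have the same
    absolute value\<close>
  define F where "F = (\<Union>(i, i') \<in> {(i, i') \<in> {..degree q} \<times> {..degree q}. P i \<noteq> P i'}.
    {\<rho>. poly (P i - P i') \<rho> = 0})"
  have "finite F"
    unfolding F_def
  proof (rule finite_UN_I)
    show "finite {(i, i') \<in> {..degree q} \<times> {..degree q}. P i \<noteq> P i'}"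
      by (rule finite_subset[of _ "{..degree q} \<times> {..degree q}"]) auto
  next
    fix ii' assume "ii' \<in> {(i, i') \<in> {..degree q} \<times> {..degree q}. P i \<noteq> P i'}"
    then show "finite (case ii' of (i, i') \<Rightarrow> {\<rho>. poly (P i - P i') \<rho> = 0})"
      using poly_roots_finite[of "P (fst ii') - P (snd ii')"]
      by (simp add: case_prod_beta del: poly_diff)
  qed
  assume "\<not> absval (coeff q j) * r ^ j \<le> B"
  moreover have "((\<lambda>\<rho>. absval (coeff q j) * \<rho> ^ j) \<longlongrightarrow> absval (coeff q j) * r ^ j) (at_left r)"
    by (intro tendsto_intros)
  ultimately have "eventually (\<lambda>\<rho>. absval (coeff q j) * \<rho> ^ j > B) (at_left r)"
    by (intro order_tendstoD(1)) auto
  then obtain a where "a < r" and a: "\<And>\<rho>. a < \<rho> \<Longrightarrow> \<rho> < r \<Longrightarrow> absval (coeff q j) * \<rho> ^ j > B"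
    using r by (auto simp: eventually_at_left)
  have "0 < max a (r / 2)" "max a (r / 2) < r" using r \<open>a < r\<close> by auto
  then obtain w :: 'a where w: "max a (r / 2) < absval w" "absval w < r" "absval w \<notin> F"
    using absval_dense_avoiding \<open>finite F\<close> by blast
  have B: "0 \<le> B" using order_trans[OF absval_nonneg bound[of 0]] r by simp
  have "absval (coeff q j * w ^ j) \<le> B"
  proof (cases "j \<le> degree q")
    case True
    have "absval (coeff q j * w ^ j) \<le> absval (\<Sum>i\<le>degree q. coeff q i * w ^ i)"
    proof (rule absval_term_le_absval_sum)
      fix i i' assume i: "i \<in> {..degree q}" "i' \<in> {..degree q}" "i \<noteq> i'" "coeff q i * w ^ i \<noteq> 0"
      then have "coeff (P i) i \<noteq> coeff (P i') i"
        using absval_pos[of "coeff q i"] by (simp add: P_def)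
      then have "P i \<noteq> P i'" by metis
      with w(3) i have "poly (P i - P i') (absval w) \<noteq> 0"
        unfolding F_def by blast
      then show "absval (coeff q i * w ^ i) \<noteq> absval (coeff q i' * w ^ i')"
        by (simp add: P_def poly_monom absval_mult absval_power)
    qed (use True in auto)
    also have "\<dots> = absval (poly q w)" by (simp add: poly_altdef)
    also have "\<dots> \<le> B" using w by (intro bound)
    finally show ?thesis .
  next
    case False
    then show ?thesis using B by (simp add: coeff_eq_0)
  qed
  then show False using a[of "absval w"] w by (simp add: absval_mult absval_power)
qed

text \<open>
  As a function of \<open>ln t\<close>, a power \<open>t ^ j\<close> is convex with slope \<open>j * s ^ j\<close> at \<open>t = s\<close>, so the
  difference is at most \<open>j * s ^ j * (ln s - ln r) = (- u * ln u) * (ln r / ln s - 1)\<close> with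
  \<open>u = s ^ j\<close>, and \<open>- u * ln u \<le> 1 - u\<close>. What matters is that the bound is independent of \<open>j\<close>.
\<close>

lemma power_diff_le_ln_ratio:
  fixes r s :: real
  assumes "0 < r" "r \<le> s" "s < 1"
  shows "s ^ j - r ^ j \<le> ln r / ln s - 1"
proof -
  define p where "p = ln r / ln s"
  have lns: "ln s < 0" using assms by simp
  have p: "p \<ge> 1" unfolding p_def using assms lns by (simp add: field_simps)
  define u where "u = s ^ j"
  have u: "0 < u" "u \<le> 1" using assms by (auto simp: u_def power_le_one)
  have ln_rj: "ln (r ^ j) = ln u + (p - 1) * ln u"
    using assms lns by (simp add: u_def ln_realpow p_def algebra_simps)
  have "r ^ j = exp (ln (r ^ j))" using assms by simp
  also have "\<dots> = u * exp ((p - 1) * ln u)"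
    unfolding ln_rj exp_add using u by simp
  finally have "u - r ^ j = u * (1 - exp ((p - 1) * ln u))" by (simp add: algebra_simps)
  also have "\<dots> \<le> u * (- ((p - 1) * ln u))"
    using u exp_ge_add_one_self[of "(p - 1) * ln u"] by (intro mult_left_mono) linarith+
  also have "\<dots> = (p - 1) * (u * ln (1 / u))"
    using u by (simp add: ln_div)
  also have "\<dots> \<le> (p - 1) * (u * (1 / u - 1))"
    using u p ln_le_minus_one[of "1 / u"] by (intro mult_left_mono) auto
  also have "\<dots> \<le> (p - 1) * 1"
    using u p by (intro mult_left_mono) (auto simp: field_simps)
  finally show ?thesis by (simp add: u_def p_def)
qed

text \<open>
  The Cauchy estimate bounds each term on the smaller circle by \<open>m\<close>. Passing to the larger circle
  adds the same amount to the bound for every term, and by the ultrametric inequality the bound for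
  the terms is a bound for their sum, whatever the degree.
\<close>

lemma poly_disk_comparison:
  fixes q :: "'a::{nonarchimedean_field, alg_closed_field} poly"
  assumes r: "0 < r" "r \<le> s" "s < 1"
    and coeff: "\<And>j. absval (coeff q j) \<le> A"
    and bound: "\<And>w. absval w \<le> r \<Longrightarrow> absval (poly q w) \<le> m"
    and w: "absval w \<le> s"
  shows "absval (poly q w) \<le> m + A * (ln r / ln s - 1)"
proof -
  have A: "0 \<le> A" using order_trans[OF absval_nonneg coeff[of 0]] .
  have m: "0 \<le> m" using order_trans[OF absval_nonneg bound[of 0]] r by simp
  have "ln r / ln s \<ge> 1" using r by (simp add: field_simps)
  have "absval (\<Sum>i\<le>degree q. coeff q i * w ^ i) \<le> m + A * (ln r / ln s - 1)"
  proof (rule absval_sum_le)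
    fix i
    have "absval (coeff q i * w ^ i) \<le> absval (coeff q i) * s ^ i"
      using w by (simp add: absval_mult absval_power mult_left_mono power_mono)
    also have "\<dots> = absval (coeff q i) * r ^ i + absval (coeff q i) * (s ^ i - r ^ i)"
      by (simp add: algebra_simps)
    also have "\<dots> \<le> m + A * (ln r / ln s - 1)"
    proof (rule add_mono)
      show "absval (coeff q i) * r ^ i \<le> m"
        using r bound by (intro poly_Cauchy_estimate) auto
      show "absval (coeff q i) * (s ^ i - r ^ i) \<le> A * (ln r / ln s - 1)"
        using r A coeff power_diff_le_ln_ratio[OF r] by (intro mult_mono) (auto simp: power_mono)
    qed
    finally show "absval (coeff q i * w ^ i) \<le> m + A * (ln r / ln s - 1)" .
  qed (use A m \<open>ln r / ln s \<ge> 1\<close> in auto)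
  then show ?thesis by (simp add: poly_altdef)
qed

section \<open>Bounded power series\<close>

definition fps_truncation :: "'a::nonarchimedean_field fps \<Rightarrow> nat \<Rightarrow> 'a poly" where
  "fps_truncation f N = (\<Sum>n<N. monom (fps_nth f n) n)"

lemma poly_fps_truncation: "poly (fps_truncation f N) w = (\<Sum>n<N. fps_nth f n * w ^ n)"
  by (simp add: fps_truncation_def poly_sum poly_monom)

lemma coeff_fps_truncation: "coeff (fps_truncation f N) j = (if j < N then fps_nth f j else 0)"
  by (simp add: fps_truncation_def coeff_sum)

lemma mem_ball_absval: "w \<in> ball 0 1 \<longleftrightarrow> absval w < 1" for w :: "'a::nonarchimedean_field"
  using absval_minus_commute[of 0 w] by (simp add: dist_absval)

lemma mem_cball_absval: "w \<in> cball z r \<longleftrightarrow> absval (w - z) \<le> r" for w :: "'a::nonarchimedean_field"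
  using absval_minus_commute[of z w] by (simp add: dist_absval)

text \<open>
  The terms at a point \<open>v\<close> with \<open>r < absval v < 1\<close> are bounded, so on the disk of radius \<open>r\<close>
  the terms decay geometrically. By the ultrametric inequality a tail is no larger than its
  largest term.
\<close>

lemma H_infinity_uniform_approx:
  fixes f :: "'a::{nonarchimedean_field, alg_closed_field} fps"
  assumes f: "f \<in> H_infinity" and r: "0 < r" "r < 1" and e: "0 < e"
  shows "\<exists>N0. \<forall>N\<ge>N0. \<forall>w. absval w \<le> r \<longrightarrow>
    absval (fps_value f w - poly (fps_truncation f N) w) \<le> e"
proof -
  have sums: "(\<lambda>N. poly (fps_truncation f N) w) \<longlonglongrightarrow> fps_value f w" if "absval w < 1" for w
    using f mem_ball_absval[THEN iffD2, OF that]
    unfolding H_infinity_def poly_fps_truncation fps_value_def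
    by (intro summable_LIMSEQ) blast
  obtain v :: 'a where v: "r < absval v" "absval v < 1"
    using absval_dense[of r 1] r by auto
  define T where "T N = poly (fps_truncation f N) v" for N
  have "Cauchy T"
    using sums[OF v(2)] by (auto intro: LIMSEQ_imp_Cauchy simp: T_def[abs_def])
  then have "bounded (range T)" by (rule cauchy_imp_bounded)
  then obtain K where K: "\<And>n. dist 0 (T n) \<le> K"
    using bounded_any_center[of "range T" 0] by auto
  have term_le: "absval (fps_nth f n) * absval v ^ n \<le> K" for n
  proof -
    have "fps_nth f n * v ^ n = T (Suc n) - T n" by (simp add: T_def poly_fps_truncation)
    moreover have "absval (T n) \<le> K" for n
      using K[of n] absval_minus_commute[of 0 "T n"] by (simp add: dist_absval)
    ultimately have "absval (fps_nth f n * v ^ n) \<le> K"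
      using absval_diff[of "T (Suc n)" "T n"] order_trans by (metis max.bounded_iff)
    then show ?thesis by (simp add: absval_mult absval_power)
  qed
  have K0: "0 \<le> K" using order_trans[OF zero_le_dist K[of 0]] .
  define t where "t = r / absval v"
  have t: "0 < t" "t < 1" using v r by (auto simp: t_def)
  have "(\<lambda>n. K * t ^ n) \<longlonglongrightarrow> K * 0"
    using t by (intro tendsto_intros LIMSEQ_power_zero) auto
  then have "eventually (\<lambda>n. K * t ^ n < e) sequentially"
    using e by (auto dest: order_tendstoD)
  then obtain N0 where N0: "\<And>n. n \<ge> N0 \<Longrightarrow> K * t ^ n < e"
    by (auto simp: eventually_sequentially)
  have term_e: "absval (fps_nth f n * w ^ n) \<le> e" if "n \<ge> N0" "absval w \<le> r" for n w
  proof -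
    have "absval (fps_nth f n * w ^ n) \<le> absval (fps_nth f n) * r ^ n"
      using that by (simp add: absval_mult absval_power mult_left_mono power_mono)
    also have "\<dots> = absval (fps_nth f n) * absval v ^ n * t ^ n"
      using v r by (simp add: t_def power_divide)
    also have "\<dots> \<le> K * t ^ n"
      using term_le t by (intro mult_right_mono) auto
    finally show ?thesis using N0[OF that(1)] by simp
  qed
  show ?thesis
  proof (intro exI allI impI)
    fix N w assume N: "N0 \<le> N" and w: "absval (w::'a) \<le> r"
    have "eventually (\<lambda>M. dist (poly (fps_truncation f M) w) (poly (fps_truncation f N) w) \<le> e) sequentially"
      using eventually_ge_at_top[of N]
    proof eventually_elim
      case (elim M)
      have "poly (fps_truncation f M) w - poly (fps_truncation f N) w
          = (\<Sum>n\<in>{N..<M}. fps_nth f n * w ^ n)"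
        using sum_diff_nat_ivl[of 0 N M "\<lambda>n. fps_nth f n * w ^ n"] elim
        by (simp add: poly_fps_truncation lessThan_atLeast0)
      also have "absval \<dots> \<le> e"
        using N w e by (intro absval_sum_le term_e) auto
      finally show ?case by (simp add: dist_absval)
    qed
    moreover have "(\<lambda>M. dist (poly (fps_truncation f M) w) (poly (fps_truncation f N) w)) \<longlonglongrightarrow>
        dist (fps_value f w) (poly (fps_truncation f N) w)"
      using w r by (intro tendsto_intros sums) auto
    ultimately have "dist (fps_value f w) (poly (fps_truncation f N) w) \<le> e"
      by (intro tendsto_upperbound) auto
    then show "absval (fps_value f w - poly (fps_truncation f N) w) \<le> e"
      by (simp add: dist_absval)
  qed
qed

lemma H_infinity_value_bound:
  fixes f :: "'a::nonarchimedean_field fps"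
  assumes "f \<in> H_infinity"
  obtains B where "0 < B" "\<And>w. absval w < 1 \<Longrightarrow> absval (fps_value f w) \<le> B"
proof -
  obtain B where B: "\<forall>y \<in> fps_value f ` ball 0 1. dist 0 y \<le> B"
    using assms bounded_any_center[of _ 0] unfolding H_infinity_def by blast
  have "absval (fps_value f w) \<le> max B 1" if "absval w < 1" for w
  proof -
    have "dist 0 (fps_value f w) \<le> B"
      using B mem_ball_absval[THEN iffD2, OF that] by blast
    then show ?thesis
      using absval_minus_commute[of 0 "fps_value f w"] by (simp add: dist_absval)
  qed
  then show thesis by (intro that[of "max B 1"]) auto
qed

text \<open>
  On a disk of radius \<open>\<rho> < 1\<close> a long truncation is bounded by the bound for \<open>f\<close>, so the
  Cauchy estimate for polynomials applies; then \<open>\<rho>\<close> tends to 1.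
\<close>

lemma H_infinity_coeff_bound:
  fixes f :: "'a::{nonarchimedean_field, alg_closed_field} fps"
  assumes f: "f \<in> H_infinity" and B: "0 < B" "\<And>w. absval w < 1 \<Longrightarrow> absval (fps_value f w) \<le> B"
  shows "absval (fps_nth f n) \<le> B"
proof -
  have *: "absval (fps_nth f n) * \<rho> ^ n \<le> B" if \<rho>: "0 < \<rho>" "\<rho> < 1" for \<rho>
  proof -
    \<comment> \<open>accuracy \<open>B\<close> suffices: by the ultrametric inequality the truncation keeps the bound \<open>B\<close>\<close>
    obtain N0 where N0: "\<forall>N\<ge>N0. \<forall>w. absval w \<le> \<rho> \<longrightarrow>
        absval (fps_value f w - poly (fps_truncation f N) w) \<le> B"
      using H_infinity_uniform_approx[OF f \<rho> B(1)] by blast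
    define q where "q = fps_truncation f (max N0 (Suc n))"
    have "absval (coeff q n) * \<rho> ^ n \<le> B"
    proof (rule poly_Cauchy_estimate)
      fix w :: 'a assume w: "absval w < \<rho>"
      then have "absval (fps_value f w - poly q w) \<le> B" "absval (fps_value f w) \<le> B"
        using N0 B \<rho> by (auto simp: q_def)
      then show "absval (poly q w) \<le> B"
        using absval_diff[of "fps_value f w" "fps_value f w - poly q w"] by simp
    qed (rule \<rho>)
    moreover have "coeff q n = fps_nth f n"
      unfolding q_def coeff_fps_truncation by (intro if_P) linarith
    ultimately show ?thesis by simp
  qed
  have "((\<lambda>\<rho>. absval (fps_nth f n) * \<rho> ^ n) \<longlongrightarrow> absval (fps_nth f n) * 1 ^ n) (at_left 1)"
    by (intro tendsto_intros)
  moreover have "eventually (\<lambda>\<rho>. absval (fps_nth f n) * \<rho> ^ n \<le> B) (at_left 1)"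
    unfolding eventually_at_left_field using * by (intro exI[of _ 0]) auto
  ultimately have "absval (fps_nth f n) * 1 ^ n \<le> B"
    by (rule tendsto_upperbound) simp
  then show ?thesis by simp
qed

lemma disk_subset_unit_disk:
  fixes z :: "'a::nonarchimedean_field"
  assumes "absval z < 1" "r < 1" "w \<in> cball z r"
  shows "absval w \<le> max (absval z) r" "absval w < 1"
  using absval_add[of z "w - z"] assms unfolding mem_cball_absval by auto

lemma absval_le_disk_seminorm:
  fixes z :: "'a::nonarchimedean_field"
  assumes "\<And>w. absval w < 1 \<Longrightarrow> absval (fps_value f w) \<le> B"
    and "absval z < 1" "r < 1" "w \<in> cball z r"
  shows "absval (fps_value f w) \<le> disk_seminorm (cball z r) f"
  unfolding disk_seminorm_def
  using assms disk_subset_unit_disk[OF assms(2,3)]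
  by (intro cSUP_upper bdd_aboveI2[where M = B]) auto

lemma disk_seminorm_le:
  assumes "0 \<le> r" "\<And>w. w \<in> cball z r \<Longrightarrow> absval (fps_value f w) \<le> B"
  shows "disk_seminorm (cball z r) f \<le> B"
  unfolding disk_seminorm_def using assms by (intro cSUP_least) auto

text \<open>
  Translation to the centre \<open>z\<close> is done on truncations, where it is composition with
  \<open>X + z\<close>. It preserves the bound on the coefficients, by the Cauchy estimate on the unit disk.
\<close>

lemma disk_seminorm_comparison:
  fixes f :: "'a::{nonarchimedean_field, alg_closed_field} fps"
  assumes f: "f \<in> H_infinity" and B: "0 < B" "\<And>w. absval w < 1 \<Longrightarrow> absval (fps_value f w) \<le> B"
    and z: "absval z < 1" and r: "0 < r" "r \<le> s" "s < 1"
  shows "disk_seminorm (cball z s) f \<le> disk_seminorm (cball z r) f + B * (ln r / ln s - 1)"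
proof (rule disk_seminorm_le)
  fix w assume w: "w \<in> cball z s"
  let ?\<delta> = "B * (ln r / ln s - 1)" and ?m = "disk_seminorm (cball z r) f"
  have m: "absval (fps_value f y) \<le> ?m" if "y \<in> cball z r" for y
    using absval_le_disk_seminorm[OF B(2) z _ that] r by simp
  have m0: "0 \<le> ?m"
    using order_trans[OF absval_nonneg m[of z]] r by simp
  have d0: "0 \<le> ?\<delta>"
    using B r by (simp add: field_simps)
  show "absval (fps_value f w) \<le> ?m + ?\<delta>"
  proof (rule field_le_epsilon)
    fix e :: real assume e: "0 < e"
    define \<rho> where "\<rho> = max (absval z) s"
    have "0 < \<rho>" "\<rho> < 1" using z r by (auto simp: \<rho>_def)
    then obtain N where N: "\<And>y. absval y \<le> \<rho> \<Longrightarrow>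
        absval (fps_value f y - poly (fps_truncation f N) y) \<le> e"
      using H_infinity_uniform_approx[OF f _ _ e, of \<rho>] by blast
    define q where "q = pcompose (fps_truncation f N) [:z, 1:]"
    have q: "poly q y = poly (fps_truncation f N) (z + y)" for y
      by (simp add: q_def poly_pcompose)
    have coeff: "absval (coeff q j) \<le> B" for j
    proof -
      have "absval (coeff q j) * 1 ^ j \<le> B"
      proof (rule poly_Cauchy_estimate)
        fix y :: 'a assume "absval y < 1"
        then have zy: "absval (z + y) \<le> 1" using absval_add[of z y] z by simp
        show "absval (poly q y) \<le> B"
          unfolding q poly_fps_truncation
        proof (rule absval_sum_le)
          fix i
          show "absval (fps_nth f i * (z + y) ^ i) \<le> B"
            using mult_mono[OF H_infinity_coeff_bound[OF f B, of i] power_le_one[OF absval_nonneg zy, of i]] B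
            by (simp add: absval_mult absval_power)
        qed (use B in simp)
      qed simp
      then show ?thesis by simp
    qed
    have approx: "absval (fps_value f y - poly q (y - z)) \<le> e" if "y \<in> cball z s" for y
      using N[of y] disk_subset_unit_disk(1)[OF z r(3) that] by (simp add: q \<rho>_def)
    have "absval (poly q (w - z)) \<le> (?m + e) + ?\<delta>"
    proof (rule poly_disk_comparison[OF r coeff])
      fix y :: 'a assume y: "absval y \<le> r"
      then have yz: "z + y \<in> cball z r" "z + y \<in> cball z s"
        using r unfolding mem_cball_absval by auto
      then have "absval (poly q y) \<le> max ?m e"
        using absval_diff[of "fps_value f (z + y)" "fps_value f (z + y) - poly q y"]
          approx[of "z + y"] m[of "z + y"] by (simp add: max_def split: if_splits)
      then show "absval (poly q y) \<le> ?m + e" using m0 e by auto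
    qed (use w in \<open>simp only: mem_cball_absval\<close>)
    then show "absval (fps_value f w) \<le> ?m + ?\<delta> + e"
      using absval_add[of "fps_value f w - poly q (w - z)" "poly q (w - z)"] approx[OF w] m0 d0
      by (simp add: max_def split: if_splits)
  qed
qed (use r in simp)

lemma disk_seminorm_mono:
  fixes z :: "'a::nonarchimedean_field"
  assumes "\<And>w. absval w < 1 \<Longrightarrow> absval (fps_value f w) \<le> B"
    and "absval z < 1" "0 \<le> r" "r \<le> s" "s < 1"
  shows "disk_seminorm (cball z r) f \<le> disk_seminorm (cball z s) f"
  using assms by (intro disk_seminorm_le absval_le_disk_seminorm) (auto simp: mem_cball_absval)

lemma disk_seminorm_dist_le:
  fixes f :: "'a::{nonarchimedean_field, alg_closed_field} fps"
  assumes f: "f \<in> H_infinity" and B: "0 < B" "\<And>w. absval w < 1 \<Longrightarrow> absval (fps_value f w) \<le> B"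
    and z: "absval z < 1" and r: "r \<in> {0<..<1}" and s: "s \<in> {0<..<1}"
  shows "\<bar>disk_seminorm (cball z s) f - disk_seminorm (cball z r) f\<bar>
    \<le> B * (\<bar>ln r / ln s - 1\<bar> + \<bar>ln s / ln r - 1\<bar>)"
proof -
  have *: "\<bar>disk_seminorm (cball z s) f - disk_seminorm (cball z r) f\<bar>
      \<le> B * (\<bar>ln r / ln s - 1\<bar> + \<bar>ln s / ln r - 1\<bar>)" if "0 < r" "r \<le> s" "s < 1" for r s
  proof -
    have "\<bar>disk_seminorm (cball z s) f - disk_seminorm (cball z r) f\<bar> \<le> B * (ln r / ln s - 1)"
      using disk_seminorm_mono[OF B(2) z, of r s] disk_seminorm_comparison[OF f B z that] that by simp
    also have "\<dots> \<le> B * (\<bar>ln r / ln s - 1\<bar> + \<bar>ln s / ln r - 1\<bar>)"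
      using B by (intro mult_left_mono) auto
    finally show ?thesis .
  qed
  show ?thesis
    using *[of r s] *[of s r] r s by (cases "r \<le> s") (auto simp: abs_minus_commute add.commute)
qed

section \<open>Limits along ultrafilters\<close>

text \<open>
  A cluster point of the image of an ultrafilter is a limit, since the complement of a
  neighbourhood of a cluster point cannot belong to the ultrafilter.
\<close>

lemma ultrafilter_limit_in_compact:
  fixes g :: "'i \<Rightarrow> 'b::topological_space"
  assumes U: "is_ultrafilter U" and K: "compact K" "\<And>i. g i \<in> K"
  shows "\<exists>l. (g \<longlongrightarrow> l) U"
proof -
  have "filtermap g U \<noteq> bot"
    using U by (simp add: is_ultrafilter_def filtermap_bot_iff)
  moreover have "eventually (\<lambda>x. x \<in> K) (filtermap g U)"
    using K by (simp add: eventually_filtermap)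
  ultimately obtain l where l: "inf (nhds l) (filtermap g U) \<noteq> bot"
    using K(1) unfolding compact_filter by blast
  have "(g \<longlongrightarrow> l) U"
  proof (rule topological_tendstoI)
    fix S assume S: "open S" "l \<in> S"
    show "eventually (\<lambda>i. g i \<in> S) U"
    proof (rule ccontr)
      assume "\<not> eventually (\<lambda>i. g i \<in> S) U"
      then have "eventually (\<lambda>x. x \<notin> S) (filtermap g U)"
        using U by (auto simp: is_ultrafilter_def eventually_filtermap)
      moreover have "eventually (\<lambda>x. x \<in> S) (nhds l)"
        using S by (rule eventually_nhds_in_open)
      ultimately have "eventually (\<lambda>x. False) (inf (nhds l) (filtermap g U))"
        unfolding eventually_inf by fast
      then show False using l by (simp add: trivial_limit_def)
    qed
  qed
  then show ?thesis by blast
qed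

lemma ln_ratio_tendsto_one:
  fixes r s :: "'i \<Rightarrow> real" and k :: "'i \<Rightarrow> nat"
  assumes "\<And>n. k n \<ge> 1" "\<And>n. r n \<in> {0<..<1}" "\<And>n. s n \<in> {0<..<1}"
    and "((\<lambda>n. r n ^ k n) \<longlongrightarrow> c) U" "((\<lambda>n. s n ^ k n) \<longlongrightarrow> c) U"
    and "0 < c" "c \<noteq> 1"
  shows "((\<lambda>n. ln (r n) / ln (s n)) \<longlongrightarrow> 1) U"
proof -
  have "((\<lambda>n. ln (r n ^ k n) / ln (s n ^ k n)) \<longlongrightarrow> ln c / ln c) U"
    using assms by (intro tendsto_intros) auto
  moreover have "ln (r n ^ k n) / ln (s n ^ k n) = ln (r n) / ln (s n)" for n
  proof -
    have "k n \<noteq> 0" "0 < r n" "0 < s n" using assms(1-3)[of n] by auto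
    then show ?thesis by (simp add: ln_realpow)
  qed
  ultimately show ?thesis using assms by simp
qed

theorem corollary6p2:
  fixes k :: "nat \<Rightarrow> nat"
    and U :: "nat filter"
    and r s :: "nat \<Rightarrow> real"
    and c :: real
    and z :: "nat \<Rightarrow> 'a::{nonarchimedean_field, alg_closed_field, complete_space}"
  assumes "\<And>n. k n \<ge> 1"
    and "is_ultrafilter U" and "nonprincipal U"
    and "\<And>n. r n \<in> {0<..<1}" and "\<And>n. s n \<in> {0<..<1}"
    and "((\<lambda>n. r n ^ k n) \<longlongrightarrow> c) U" and "((\<lambda>n. s n ^ k n) \<longlongrightarrow> c) U"
    and "c \<noteq> 0" and "c \<noteq> 1"
    and "\<And>n. z n \<in> ball 0 1"
    and "\<And>n. r n < absval (z n)" and "\<And>n. s n < absval (z n)"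
  shows "\<exists>\<phi>. seminorm_limit (\<lambda>n. disk_seminorm (cball (z n) (r n))) \<phi> U \<and>
             seminorm_limit (\<lambda>n. disk_seminorm (cball (z n) (s n))) \<phi> U"
proof -
  have z: "absval (z n) < 1" for n
    using assms(10) by (simp only: mem_ball_absval)
  have "U \<noteq> bot" using assms(2) by (simp add: is_ultrafilter_def)
  have "0 \<le> r n ^ k n" for n using assms(4)[of n] by simp
  then have "0 \<le> c"
    using \<open>U \<noteq> bot\<close> by (intro tendsto_lowerbound[OF assms(6)]) auto
  then have c: "0 < c" using assms(8) by simp
  have rs: "((\<lambda>n. ln (r n) / ln (s n)) \<longlongrightarrow> 1) U" and sr: "((\<lambda>n. ln (s n) / ln (r n)) \<longlongrightarrow> 1) U"
    using ln_ratio_tendsto_one[OF assms(1,4,5,6,7) c assms(9)]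
      ln_ratio_tendsto_one[OF assms(1,5,4,7,6) c assms(9)] by auto
  have "\<exists>l. ((\<lambda>n. disk_seminorm (cball (z n) (r n)) f) \<longlongrightarrow> l) U \<and>
      ((\<lambda>n. disk_seminorm (cball (z n) (s n)) f) \<longlongrightarrow> l) U" if f: "f \<in> H_infinity" for f
  proof -
    obtain B where B: "0 < B" "\<And>w. absval w < 1 \<Longrightarrow> absval (fps_value f w) \<le> B"
      using H_infinity_value_bound[OF f] by blast
    let ?R = "\<lambda>n. disk_seminorm (cball (z n) (r n)) f"
    let ?S = "\<lambda>n. disk_seminorm (cball (z n) (s n)) f"
    have "?R n \<in> {0..B}" for n
    proof -
      have "r n \<in> {0<..<1}" by (rule assms)
      then have "absval (fps_value f (z n)) \<le> ?R n" "?R n \<le> B"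
        using disk_subset_unit_disk(2)[OF z] z B
        by (auto intro!: absval_le_disk_seminorm disk_seminorm_le)
      then show ?thesis using order_trans[OF absval_nonneg] by auto
    qed
    then obtain l where l: "(?R \<longlongrightarrow> l) U"
      using ultrafilter_limit_in_compact[OF assms(2), of "{0..B}" ?R] by auto
    have "((\<lambda>n. B * (\<bar>ln (r n) / ln (s n) - 1\<bar> + \<bar>ln (s n) / ln (r n) - 1\<bar>)) \<longlongrightarrow>
        B * (\<bar>1 - 1\<bar> + \<bar>1 - 1\<bar>)) U"
      by (intro tendsto_intros rs sr)
    then have bound_to_0: "((\<lambda>n. B * (\<bar>ln (r n) / ln (s n) - 1\<bar> + \<bar>ln (s n) / ln (r n) - 1\<bar>)) \<longlongrightarrow> 0) U"
      by simp
    have "((\<lambda>n. ?S n - ?R n) \<longlongrightarrow> 0) U"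
    proof (rule Lim_null_comparison[OF always_eventually bound_to_0], rule allI)
      show "norm (?S n - ?R n) \<le> B * (\<bar>ln (r n) / ln (s n) - 1\<bar> + \<bar>ln (s n) / ln (r n) - 1\<bar>)" for n
        unfolding real_norm_def by (rule disk_seminorm_dist_le[OF f B z assms(4,5)])
    qed
    from tendsto_add[OF this l] have "(?S \<longlongrightarrow> l) U" by simp
    with l show ?thesis by blast
  qed
  then obtain \<phi> where "\<forall>f\<in>H_infinity. ((\<lambda>n. disk_seminorm (cball (z n) (r n)) f) \<longlongrightarrow> \<phi> f) U \<and>
      ((\<lambda>n. disk_seminorm (cball (z n) (s n)) f) \<longlongrightarrow> \<phi> f) U"
    by metis
  then show ?thesis unfolding seminorm_limit_def by blast
qed

end
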